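(* For all $n\ge 0$ the polynomials $R_n^+(x)$, $R_n^-(x)$ and $R_n(x)$ satisfy the recurrence relations $$R_{n+1}^+(x)=2nxR_{n}^+(x)+2x(1-2x)\frac{d}{dx}R_{n}^+(x)+R_{n}(x),$$ $$R_{n+1}^-(x)=(2n+1)xR_{n}^-(x)+2x(1-2x)\frac{d}{dx}R_{n}^-(x)+xR_{n}(x),$$ $$R_{n+1}(x)=(1+(2n+1)x)R_{n}(x)+2x(1-2x)\frac{d}{dx}R_{n}(x)+xR_{n}^-(x),$$ with the initial conditions $R_0^+(x)=R_0(x)=1$ and $R_0^-(x)=0$.
   Context: Let $[n]=\{1,\dots,n\}$ and let $B_n$ be the group of signed permutations: permutations $\pi$ of $\{\pm1,\dots,\pm n\}$ with $\pi(-i)=-\pi(i)$. Each $\pi\in B_n$ is identified with the word $\pi(0)\pi(1)\cdots\pi(n)$, where $\pi(0)=0$. A double descent of $\pi\in B_n$ is an index $i\in[n-1]$ with $\pi(i-1)>\pi(i)>\pi(i+1)$ (so $i=1$ uses $\pi(0)=0$). A permutation $\pi\in B_n$ is a signed simsun permutation if for every $0\le k\le n$, the word obtained from $\pi$ by removing the $k$ entries $\pm n,\pm(n-1),\dots,\pm(n-k+1)$ (keeping the leading $0$ and the order of the remaining entries) is a signed permutation in $B_{n-k}$ with no double descents. Let $\mathcal{RB}_n$ be the set of signed simsun permutations in $B_n$, $\mathcal{RB}_n^+=\{\pi\in\mathcal{RB}_n:\pi(1)>0\}$ and $\mathcal{RB}_n^-=\{\pi\in\mathcal{RB}_n:\pi(1)<0\}$.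 The type $B$ descent number is $\mathrm{des}_B(\pi)=|\{i\in\{0,1,\dots,n-1\}:\pi(i)>\pi(i+1)\}|$. For $n\ge1$ define $R_n(x)=\sum_{\pi\in\mathcal{RB}_n}x^{\mathrm{des}_B(\pi)}$, $R_n^{+}(x)=\sum_{\pi\in\mathcal{RB}_n^{+}}x^{\mathrm{des}_B(\pi)}$ and $R_n^{-}(x)=\sum_{\pi\in\mathcal{RB}_n^{-}}x^{\mathrm{des}_B(\pi)}$; for $n=0$ the polynomials are given by the stated initial conditions. *)

theory Defs
  imports "HOL-Combinatorics.Permutations" "HOL-Computational_Algebra.Polynomial"
begin

text \<open>\<^const>\<open>permutes\<close> makes a signed permutation the identity outside
  \<open>{\<plusminus>1, \<dots>, \<plusminus>n}\<close>; in particular \<open>\<pi> 0 = 0\<close>.\<close>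

definition signed_perms :: "nat \<Rightarrow> (int \<Rightarrow> int) set" where
  "signed_perms n =
    {\<pi>. \<pi> permutes ({- int n..int n} - {0}) \<and> (\<forall>i. \<pi> (- i) = - \<pi> i)}"

definition word :: "nat \<Rightarrow> (int \<Rightarrow> int) \<Rightarrow> int list" where
  "word n \<pi> = map \<pi> [0..int n]"

definition double_descents :: "nat \<Rightarrow> (int \<Rightarrow> int) \<Rightarrow> int set" where
  "double_descents n \<pi> =
    {i \<in> {1..int n - 1}. \<pi> (i - 1) > \<pi> i \<and> \<pi> i > \<pi> (i + 1)}"

definition remove_largest :: "nat \<Rightarrow> nat \<Rightarrow> int list \<Rightarrow> int list" where
  "remove_largest n k w = filter (\<lambda>a. \<bar>a\<bar> \<notin> {int n - int k + 1..int n}) w"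

definition simsun_B :: "nat \<Rightarrow> (int \<Rightarrow> int) set" where
  "simsun_B n =
    {\<pi> \<in> signed_perms n. \<forall>k\<le>n. \<exists>\<sigma> \<in> signed_perms (n - k).
       remove_largest n k (word n \<pi>) = word (n - k) \<sigma> \<and> double_descents (n - k) \<sigma> = {}}"

definition simsun_B_plus :: "nat \<Rightarrow> (int \<Rightarrow> int) set" where
  "simsun_B_plus n = {\<pi> \<in> simsun_B n. \<pi> 1 > 0}"

definition simsun_B_minus :: "nat \<Rightarrow> (int \<Rightarrow> int) set" where
  "simsun_B_minus n = {\<pi> \<in> simsun_B n. \<pi> 1 < 0}"

definition des_B :: "nat \<Rightarrow> (int \<Rightarrow> int) \<Rightarrow> nat" where
  "des_B n \<pi> = card {i \<in> {0..int n - 1}. \<pi> i > \<pi> (i + 1)}"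

abbreviation X :: "int poly" where
  "X \<equiv> [:0, 1:]"

text \<open>The value at \<open>0\<close> is a convention: for \<open>n = 0\<close> there is no entry \<open>\<pi> 1\<close>
  whose sign could be tested.\<close>

definition R :: "nat \<Rightarrow> int poly" where
  "R n = (if n = 0 then 1 else \<Sum>\<pi>\<in>simsun_B n. X ^ des_B n \<pi>)"

definition R_plus :: "nat \<Rightarrow> int poly" where
  "R_plus n = (if n = 0 then 1 else \<Sum>\<pi>\<in>simsun_B_plus n. X ^ des_B n \<pi>)"

definition R_minus :: "nat \<Rightarrow> int poly" where
  "R_minus n = (if n = 0 then 0 else \<Sum>\<pi>\<in>simsun_B_minus n. X ^ des_B n \<pi>)"

end

theory Submission imports Defs begin

text \<open>
  Deleting the entry \<open>\<plusminus>(n + 1)\<close> from a signed simsun permutation of rank \<open>n + 1\<close> leaves one of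
  rank \<open>n\<close>, its parent, and the simsun condition on the child adds only that the child itself has no
  double descent. So the recurrences come from listing the double-descent-free ways to insert
  \<open>n + 1\<close> or \<open>-(n + 1)\<close> into a word \<open>0 v\<close> of length \<open>n + 1\<close> that has no double descent. Such a word
  has \<open>n + 1\<close> gaps after its letters, the last one being its right end. Let \<open>d\<close> be its number of
  descents.

  An insertion into a descent never creates a double descent, since neither neighbour of a descent
  is a descent, and it keeps \<open>d\<close>. Appending \<open>n + 1\<close> also keeps \<open>d\<close>. Every other insertion goes into
  an ascent, or appends \<open>-(n + 1)\<close>, and raises \<open>d\<close> by one. It is forbidden exactly when the new
  descent gets a descent next to it: for \<open>n + 1\<close> this means an ascent followed by a descent, for
  \<open>-(n + 1)\<close> an ascent, or the right end, preceded by a descent. Because descents are isolated, the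
  number of forbidden places is \<open>d\<close>, except that for \<open>n + 1\<close> a descent in the first gap has no
  ascent before it and forbids nothing. With \<open>s = 1\<close> if \<open>v\<close> starts with a negative letter and
  \<open>s = 0\<close> otherwise, the children of \<open>v\<close> thus contribute
  \[ (1 + d) x^d + (n - 2 d + s) x^{d+1} \quad\mbox{and}\quad d x^d + (n + 1 - 2 d) x^{d+1} \]
  for the two signs (\<open>sum_insert_large\<close>, \<open>sum_insert_small\<close>). Adding these over all \<open>v\<close>, with \<open>x\<close>
  times the derivative of \<open>x^d\<close> equal to \<open>d x^d\<close>, gives the recurrence for \<open>R\<close>; the term with \<open>s\<close>
  is \<open>x R\<^sup>-\<close>.

  The sign of the first letter changes only by an insertion into the first gap
  (\<open>sum_positive_children\<close>). This yields the recurrence for \<open>R\<^sup>+\<close>, and the one for \<open>R\<^sup>-\<close>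
  is the difference of the other two.
\<close>

section \<open>Descents and double descents of integer words\<close>

text \<open>
  The prefixed letter \<open>a\<close> makes a descent with the word. On the part of a word after its leading \<open>0\<close>
  and for \<open>a = 0\<close>, this says that the first letter is negative; the empty word counts as not
  negative, which matches the convention for \<open>n = 0\<close>.
\<close>

definition starts_below :: "int \<Rightarrow> int list \<Rightarrow> bool" where
  "starts_below a w \<longleftrightarrow> w \<noteq> [] \<and> hd w < a"

fun descents :: "int list \<Rightarrow> nat" where
  "descents [] = 0"
| "descents (a # w) = of_bool (starts_below a w) + descents w"

fun no_double_descent :: "int list \<Rightarrow> bool" where
  "no_double_descent [] \<longleftrightarrow> True"
| "no_double_descent [a] \<longleftrightarrow> True"
| "no_double_descent (a # b # w) \<longleftrightarrow>
    \<not> (b < a \<and> starts_below b w) \<and> no_double_descent (b # w)"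

text \<open>
  Words with a double descent have weight \<open>0\<close>, so that a sum over the allowed insertions can range
  over all insertions.
\<close>

definition weight :: "int list \<Rightarrow> int poly" where
  "weight w = (if no_double_descent w then X ^ descents w else 0)"

lemma starts_below_simps [simp]:
  "\<not> starts_below a []" "starts_below a (b # w) \<longleftrightarrow> b < a"
  by (auto simp: starts_below_def)

section \<open>Counting the insertions of an extreme letter\<close>

text \<open>
  \<^term>\<open>shuffles [c] v\<close> is the set of all words obtained by inserting \<open>c\<close> somewhere into \<open>v\<close>.
  The insertion in front is split off because it is the only one that separates \<open>b\<close> from a letter
  standing before the word.
\<close>

lemma sum_insertions_Cons:
  assumes "c \<noteq> b"
  shows "(\<Sum>w\<in>shuffles [c] (b # v). f w) = f (c # b # v) + (\<Sum>w\<in>shuffles [c] v. f (b # w))"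
proof -
  have "(\<Sum>w\<in>shuffles [c] (b # v). f w) = (\<Sum>w\<in>insert (c # b # v) ((#) b ` shuffles [c] v). f w)"
    by simp
  also have "\<dots> = f (c # b # v) + (\<Sum>w\<in>(#) b ` shuffles [c] v. f w)"
    using assms by (subst sum.insert) auto
  also have "(\<Sum>w\<in>(#) b ` shuffles [c] v. f w) = (\<Sum>w\<in>shuffles [c] v. f (b # w))"
    by (subst sum.reindex) (auto simp: inj_on_def)
  finally show ?thesis .
qed

lemma insertion_cases:
  assumes "w \<in> shuffles [c] v"
  shows "w = c # v \<or> (\<exists>b v' w'. v = b # v' \<and> w = b # w')"
  using assms by (cases v) auto

text \<open>
  The inserted letter exceeds all others. In the induction, the letter \<open>a\<close> joins the word \<open>b # v\<close> on
  the left. If \<open>a \<le> b\<close>, this only opens a new first gap, usable when \<open>b\<close> does not start a descent.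
  If \<open>a > b\<close>, then \<open>b\<close> starts no descent, and inserting a larger letter later cannot make it start
  one; so all insertions into \<open>v\<close> survive with one more descent, and the new gap keeps the
  number of descents.
\<close>

lemma sum_insert_large:
  assumes "no_double_descent (a # v)" "\<forall>x\<in>set (a # v). x < c"
  defines "d \<equiv> descents (a # v)"
  shows "(\<Sum>w\<in>shuffles [c] v. weight (a # w)) =
    (1 + of_nat d) * X ^ d
    + (of_nat (length v) - 2 * of_nat d + of_bool (starts_below a v)) * X ^ Suc d"
  using assms(1,2) unfolding d_def
proof (induction v arbitrary: a)
  case Nil
  then show ?case by (simp add: weight_def)
next
  case (Cons b v)
  have c: "a < c" "b < c" using Cons.prems by auto
  have b: "no_double_descent (b # v)" using Cons.prems by simp
  have IH: "(\<Sum>w\<in>shuffles [c] v. weight (b # w)) =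
    (1 + of_nat (descents (b # v))) * X ^ descents (b # v) +
    (of_nat (length v) - 2 * of_nat (descents (b # v)) + of_bool (starts_below b v))
      * X ^ Suc (descents (b # v))"
    using Cons.prems(2) by (intro Cons.IH[OF b]) auto
  have split: "(\<Sum>w\<in>shuffles [c] (b # v). weight (a # w)) =
      weight (a # c # b # v) + (\<Sum>w\<in>shuffles [c] v. weight (a # b # w))"
    using c by (intro sum_insertions_Cons) auto
  show ?case
  proof (cases "b < a")
    case False
    then have "weight (a # b # w) = weight (b # w)" for w
      by (simp add: weight_def)
    then show ?thesis
      using False c b unfolding split
      by (simp only: IH) (simp add: weight_def algebra_simps)
  next
    case True
    then have v: "\<not> starts_below b v" using Cons.prems by simp
    have "weight (a # b # w) = X * weight (b # w)" if "w \<in> shuffles [c] v" for w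
      using insertion_cases[OF that] True v c by (auto simp: weight_def)
    then have "(\<Sum>w\<in>shuffles [c] v. weight (a # b # w)) = X * (\<Sum>w\<in>shuffles [c] v. weight (b # w))"
      by (simp add: sum_distrib_left)
    then show ?thesis
      using True c b v unfolding split
      by (simp only: IH) (simp add: weight_def algebra_simps)
  qed
qed

text \<open>
  The inserted letter is below all others. The difference to the previous lemma is that a descent
  \<open>a > b\<close> forbids the insertion right after \<open>b\<close>, whereas the new
  gap between \<open>a\<close> and \<open>b\<close> is always usable.
\<close>

lemma sum_insert_small:
  assumes "no_double_descent (a # v)" "\<forall>x\<in>set (a # v). c < x"
  defines "d \<equiv> descents (a # v)"
  shows "(\<Sum>w\<in>shuffles [c] v. weight (a # w)) =
    of_nat d * X ^ d + (of_nat (length v) + 1 - 2 * of_nat d) * X ^ Suc d"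
  using assms(1,2) unfolding d_def
proof (induction v arbitrary: a)
  case Nil
  then show ?case by (simp add: weight_def)
next
  case (Cons b v)
  have c: "c < a" "c < b" using Cons.prems by auto
  have b: "no_double_descent (b # v)" using Cons.prems by simp
  have IH: "(\<Sum>w\<in>shuffles [c] v. weight (b # w)) =
    of_nat (descents (b # v)) * X ^ descents (b # v) +
    (of_nat (length v) + 1 - 2 * of_nat (descents (b # v))) * X ^ Suc (descents (b # v))"
    using Cons.prems(2) by (intro Cons.IH[OF b]) auto
  have split: "(\<Sum>w\<in>shuffles [c] (b # v). weight (a # w)) =
      weight (a # c # b # v) + (\<Sum>w\<in>shuffles [c] v. weight (a # b # w))"
    using c by (intro sum_insertions_Cons) auto
  show ?case
  proof (cases "b < a")
    case False
    then have "weight (a # b # w) = weight (b # w)" for w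
      by (simp add: weight_def)
    then show ?thesis
      using False c b unfolding split
      by (simp only: IH) (simp add: weight_def algebra_simps)
  next
    case True
    then have v: "\<not> starts_below b v" using Cons.prems by simp
    \<comment> \<open>The insertion right after \<open>b\<close> is valid in \<open>b # v\<close> but gives the double descent \<open>a > b > c\<close>.\<close>
    have first: "c # v \<in> shuffles [c] v" by (cases v) auto
    have "weight (b # c # v) = X ^ Suc (descents (b # v))"
      using v c b Cons.prems(2) by (cases v) (auto simp: weight_def)
    moreover have "weight (a # b # c # v) = 0"
      using True c by (simp add: weight_def)
    moreover have "weight (a # b # w) = X * weight (b # w)"
      if "w \<in> shuffles [c] v - {c # v}" for w
      using that insertion_cases[of w c v] True v c by (auto simp: weight_def)
    ultimately have "(\<Sum>w\<in>shuffles [c] v. weight (a # b # w)) =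
        X * ((\<Sum>w\<in>shuffles [c] v. weight (b # w)) - X ^ Suc (descents (b # v)))"
      by (simp add: sum.remove[OF _ first] sum_distrib_left)
    then show ?thesis
      using True c b v unfolding split
      by (simp only: IH) (simp add: weight_def algebra_simps)
  qed
qed

section \<open>The parent of a signed simsun word\<close>

definition signed_words :: "nat \<Rightarrow> int list set" where
  "signed_words n = {w. distinct (map abs w) \<and> abs ` set w = {1..int n}}"

definition truncate :: "nat \<Rightarrow> int list \<Rightarrow> int list" where
  "truncate m w = filter (\<lambda>a. \<bar>a\<bar> \<le> int m) w"

text \<open>
  These are the words of the signed simsun permutations without their leading \<open>0\<close>; the bijection is
  established by \<open>simsun_B_iff\<close> and \<open>sum_simsun_B\<close>.
\<close>

definition simsun_words :: "nat \<Rightarrow> int list set" where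
  "simsun_words n =
    {w \<in> signed_words n. \<forall>m\<le>n. no_double_descent (0 # truncate m w)}"

lemma truncate_signed_word:
  assumes "w \<in> signed_words n" "m \<le> n"
  shows "truncate m w \<in> signed_words m"
proof -
  have "abs ` set (truncate m w) = abs ` set w \<inter> {..int m}"
    by (auto simp: truncate_def)
  moreover have "distinct (map abs (truncate m w))"
    using assms by (auto simp: signed_words_def truncate_def distinct_map intro: inj_on_subset)
  ultimately show ?thesis using assms by (auto simp: signed_words_def)
qed

lemma truncate_full: "w \<in> signed_words n \<Longrightarrow> truncate n w = w"
  by (auto simp: truncate_def signed_words_def filter_id_conv)

lemma truncate_truncate: "m \<le> n \<Longrightarrow> truncate m (truncate n w) = truncate m w"
  by (auto simp: truncate_def intro!: filter_cong)

lemma length_signed_word: "w \<in> signed_words n \<Longrightarrow> length w = n"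
proof -
  assume "w \<in> signed_words n"
  then have "distinct (map abs w)" "set (map abs w) = {1..int n}"
    by (auto simp: signed_words_def)
  then show ?thesis by (metis distinct_card length_map card_atLeastAtMost_int diff_add_cancel nat_int)
qed

lemma finite_signed_words: "finite (signed_words n)"
proof (rule finite_subset)
  show "signed_words n \<subseteq> {w. set w \<subseteq> {- int n..int n} \<and> length w = n}"
  proof
    fix w assume w: "w \<in> signed_words n"
    have "x \<in> {- int n..int n}" if "x \<in> set w" for x
    proof -
      have "\<bar>x\<bar> \<in> {1..int n}" using w that by (auto simp: signed_words_def)
      then show ?thesis by auto
    qed
    then show "w \<in> {w. set w \<subseteq> {- int n..int n} \<and> length w = n}"
      using length_signed_word[OF w] by auto
  qed
  show "finite {w. set w \<subseteq> {- int n..int n} \<and> length w = n}"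
    by (intro finite_lists_length_eq) auto
qed

text \<open>
  A word of rank \<open>n + 1\<close> is one letter longer than its truncation, so truncation removes a single
  letter, of absolute value \<open>n + 1\<close>; conversely each insertion of such a letter is undone by
  truncation.
\<close>

lemma truncate_fibre:
  assumes v: "v \<in> signed_words n"
  shows "{w \<in> signed_words (Suc n). truncate n w = v} =
    shuffles [int (Suc n)] v \<union> shuffles [- int (Suc n)] v" (is "?L = ?R")
proof (intro equalityI subsetI)
  fix w assume w: "w \<in> ?L"
  let ?big = "filter (\<lambda>a. \<not> \<bar>a\<bar> \<le> int n) w"
  have dist: "distinct (map abs w)" and abs_w: "abs ` set w = {1..int (Suc n)}"
    using w by (auto simp: signed_words_def)
  have "length w = length v + length ?big"
    using w sum_length_filter_compl[of "\<lambda>a. \<bar>a\<bar> \<le> int n" w] by (auto simp: truncate_def)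
  moreover have "length w = Suc n" "length v = n"
    using w v by (auto simp: length_signed_word)
  ultimately have "length ?big = 1" by simp
  then obtain c where c: "?big = [c]" by (auto simp: length_Suc_conv)
  then have "c \<in> set ?big" by simp
  then have "c \<in> set w" "\<not> \<bar>c\<bar> \<le> int n" by auto
  then have "c = int (Suc n) \<or> c = - int (Suc n)"
    using abs_w by (smt (verit) atLeastAtMost_iff imageI of_nat_Suc)
  moreover have "w \<in> shuffles v [c]"
    using partition_in_shuffles[of w "\<lambda>a. \<bar>a\<bar> \<le> int n"] w c by (simp add: truncate_def)
  ultimately show "w \<in> ?R" by (auto simp: shuffles_commutes[of v])
next
  fix w assume "w \<in> ?R"
  then obtain c where w: "w \<in> shuffles [c] v" and c: "\<bar>c\<bar> = int (Suc n)" by auto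
  have v': "distinct v" "inj_on abs (set v)" "abs ` set v = {1..int n}"
    using v by (auto simp: signed_words_def distinct_map)
  have abs_c: "\<bar>c\<bar> \<notin> abs ` set v" unfolding v'(3) using c by simp
  then have c_notin: "c \<notin> set v" by blast
  have "distinct w"
    by (rule distinct_disjoint_shuffles[OF _ v'(1) _ w]) (simp_all add: c_notin)
  moreover have set_w: "set w = insert c (set v)" using set_shuffles[OF w] by simp
  moreover have "inj_on abs (insert c (set v))"
    using v'(2) abs_c by (simp only: inj_on_insert) blast
  moreover have "abs ` insert c (set v) = {1..int (Suc n)}"
    unfolding image_insert v'(3) c by auto
  ultimately have "w \<in> signed_words (Suc n)"
    by (simp only: signed_words_def distinct_map mem_Collect_eq simp_thms)
  moreover have "truncate n w = v"
  proof -
    have "truncate n w \<in> truncate n ` shuffles [c] v" using w by simp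
    also have "\<dots> = shuffles (truncate n [c]) (truncate n v)"
      unfolding truncate_def by (rule filter_shuffles)
    also have "\<dots> = {v}" using c truncate_full[OF v] by (simp add: truncate_def)
    finally show ?thesis by simp
  qed
  ultimately show "w \<in> ?L" by simp
qed

text \<open>
  All truncations to a rank \<open>m \<le> n\<close> factor through the parent, so only the word itself adds a
  condition.
\<close>

lemma simsun_words_Suc:
  "simsun_words (Suc n) =
    {w \<in> signed_words (Suc n). truncate n w \<in> simsun_words n \<and> no_double_descent (0 # w)}"
proof -
  have "(\<forall>m\<le>Suc n. no_double_descent (0 # truncate m w)) \<longleftrightarrow>
      (\<forall>m\<le>n. no_double_descent (0 # truncate m (truncate n w))) \<and> no_double_descent (0 # w)"
    if "w \<in> signed_words (Suc n)" for w
    using truncate_full[OF that] by (auto simp: le_Suc_eq truncate_truncate)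
  then show ?thesis
    using truncate_signed_word[of _ "Suc n" n] by (auto simp: simsun_words_def)
qed

lemma finite_simsun_words: "finite (simsun_words n)"
  by (rule finite_subset[OF _ finite_signed_words[of n]]) (auto simp: simsun_words_def)

text \<open>
  Grouping the words of rank \<open>n + 1\<close> by their parent turns a sum over them into a sum over
  insertions.
\<close>

lemma sum_simsun_words_Suc:
  "(\<Sum>w\<in>simsun_words (Suc n). f w) =
    (\<Sum>v\<in>simsun_words n.
      (\<Sum>w\<in>shuffles [int (Suc n)] v. if no_double_descent (0 # w) then f w else 0) +
      (\<Sum>w\<in>shuffles [- int (Suc n)] v. if no_double_descent (0 # w) then f w else 0))"
proof -
  let ?S = "{w \<in> signed_words (Suc n). truncate n w \<in> simsun_words n}"
  let ?g = "\<lambda>w. if no_double_descent (0 # w) then f w else 0"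
  have fin: "finite ?S" by (simp add: finite_signed_words)
  have "(\<Sum>w\<in>simsun_words (Suc n). f w) = (\<Sum>w\<in>{w \<in> ?S. no_double_descent (0 # w)}. f w)"
    by (rule sum.cong) (auto simp: simsun_words_Suc)
  also have "\<dots> = (\<Sum>w\<in>?S. ?g w)" by (rule sum.inter_filter[OF fin])
  also have "\<dots> = (\<Sum>v\<in>simsun_words n. \<Sum>w\<in>{w \<in> ?S. truncate n w = v}. ?g w)"
    by (rule sum.group[symmetric, OF fin finite_simsun_words]) auto
  also have "\<dots> = (\<Sum>v\<in>simsun_words n. (\<Sum>w\<in>shuffles [int (Suc n)] v. ?g w) +
      (\<Sum>w\<in>shuffles [- int (Suc n)] v. ?g w))"
  proof (rule sum.cong[OF refl])
    fix v assume v: "v \<in> simsun_words n"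
    then have v': "v \<in> signed_words n" by (simp add: simsun_words_def)
    then have abs_v: "abs ` set v = {1..int n}" by (simp add: signed_words_def)
    have "{w \<in> ?S. truncate n w = v} = shuffles [int (Suc n)] v \<union> shuffles [- int (Suc n)] v"
      using truncate_fibre[OF v'] v by auto
    moreover have "int (Suc n) \<notin> set v" using abs_v by force
    then have "shuffles [int (Suc n)] v \<inter> shuffles [- int (Suc n)] v = {}"
      using set_shuffles[of _ "[int (Suc n)]" v] set_shuffles[of _ "[- int (Suc n)]" v]
      by fastforce
    ultimately show "(\<Sum>w\<in>{w \<in> ?S. truncate n w = v}. ?g w) =
        (\<Sum>w\<in>shuffles [int (Suc n)] v. ?g w) + (\<Sum>w\<in>shuffles [- int (Suc n)] v. ?g w)"
      by (simp add: sum.union_disjoint)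
  qed
  finally show ?thesis .
qed


section \<open>The recurrences for simsun words\<close>

text \<open>These are the hypotheses of the two insertion counts, for the extreme letters \<open>\<plusminus>(n + 1)\<close>.\<close>

lemma simsun_word_bounds:
  assumes "v \<in> simsun_words n"
  shows "length v = n" "no_double_descent (0 # v)"
    "\<forall>x\<in>set (0 # v). x < int (Suc n)" "\<forall>x\<in>set (0 # v). - int (Suc n) < x"
proof -
  have v: "v \<in> signed_words n" using assms by (simp add: simsun_words_def)
  then show "length v = n" by (rule length_signed_word)
  show "no_double_descent (0 # v)"
    using assms truncate_full[OF v] by (auto simp: simsun_words_def)
  have "\<bar>x\<bar> \<le> int n" if "x \<in> set v" for x
  proof -
    have "\<bar>x\<bar> \<in> {1..int n}" using v that by (auto simp: signed_words_def)
    then show ?thesis by simp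
  qed
  then show "\<forall>x\<in>set (0 # v). x < int (Suc n)" "\<forall>x\<in>set (0 # v). - int (Suc n) < x"
    by fastforce+
qed

definition word_poly :: "nat \<Rightarrow> int poly" where
  "word_poly n = (\<Sum>w\<in>simsun_words n. X ^ descents (0 # w))"

definition word_poly_plus :: "nat \<Rightarrow> int poly" where
  "word_poly_plus n =
    (\<Sum>w\<in>simsun_words n. of_bool (\<not> starts_below 0 w) * X ^ descents (0 # w))"

definition word_poly_minus :: "nat \<Rightarrow> int poly" where
  "word_poly_minus n =
    (\<Sum>w\<in>simsun_words n. of_bool (starts_below 0 w) * X ^ descents (0 # w))"

lemma word_poly_split: "word_poly n = word_poly_plus n + word_poly_minus n"
  by (auto simp: word_poly_def word_poly_plus_def word_poly_minus_def
      simp flip: sum.distrib intro!: sum.cong)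

lemma sum_all_children:
  assumes v: "v \<in> simsun_words n"
  defines "d \<equiv> descents (0 # v)"
  shows "(\<Sum>w\<in>shuffles [int (Suc n)] v. weight (0 # w)) +
      (\<Sum>w\<in>shuffles [- int (Suc n)] v. weight (0 # w)) =
    (1 + 2 * of_nat d) * X ^ d
    + (2 * of_nat n + 1 - 4 * of_nat d + of_bool (starts_below 0 v)) * X ^ Suc d"
  unfolding d_def
    sum_insert_large[OF simsun_word_bounds(2,3)[OF v]]
    sum_insert_small[OF simsun_word_bounds(2,4)[OF v]] simsun_word_bounds(1)[OF v]
  by (simp add: algebra_simps)

text \<open>
  A child has the sign of its parent unless the new letter comes first. So a parent that starts with
  a negative letter has a single positive child, with \<open>n + 1\<close> in front; there the first descent
  merely moves one place to the right. Of the children of any other parent, all are positive except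
  the one with \<open>-(n + 1)\<close> in front, which has one descent more than the parent.
\<close>

lemma sum_positive_children:
  assumes v: "v \<in> simsun_words n"
  defines "d \<equiv> descents (0 # v)"
  shows "(\<Sum>w\<in>shuffles [int (Suc n)] v. of_bool (\<not> starts_below 0 w) * weight (0 # w)) +
      (\<Sum>w\<in>shuffles [- int (Suc n)] v. of_bool (\<not> starts_below 0 w) * weight (0 # w)) =
    X ^ d + of_bool (\<not> starts_below 0 v) *
      (2 * of_nat d * X ^ d + (2 * of_nat n - 4 * of_nat d) * X ^ Suc d)"
    (is "?P + ?M = _")
proof -
  let ?N = "int (Suc n)"
  let ?g = "\<lambda>w. of_bool (\<not> starts_below 0 w) * weight (0 # w)"
  note b = simsun_word_bounds[OF v]
  have first: "c # v \<in> shuffles [c] v" for c by (cases v) auto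
  have rest: "starts_below 0 w = starts_below 0 v \<and> v \<noteq> []"
    if "w \<in> shuffles [c] v - {c # v}" for w c
    using that insertion_cases[of w c v] by auto
  show ?thesis
  proof (cases "starts_below 0 v")
    case True
    have "?P = weight (0 # ?N # v)"
      using rest True by (subst sum.remove[OF _ first]) auto
    also have "\<dots> = X ^ d"
      using True b unfolding d_def by (cases v) (auto simp: weight_def)
    finally have "?P = X ^ d" .
    moreover have "?M = 0"
      using rest True by (subst sum.remove[OF _ first]) auto
    ultimately show ?thesis using True by simp
  next
    case False
    have "?P = (\<Sum>w\<in>shuffles [?N] v. weight (0 # w))"
    proof (rule sum.cong[OF refl])
      fix w assume "w \<in> shuffles [?N] v"
      then have "\<not> starts_below 0 w"
        using insertion_cases[of w ?N v] False by auto
      then show "?g w = weight (0 # w)" by simp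
    qed
    moreover have "?M = (\<Sum>w\<in>shuffles [- ?N] v. weight (0 # w)) - weight (0 # (- ?N) # v)"
    proof -
      have "?M = ?g ((- ?N) # v) + (\<Sum>w\<in>shuffles [- ?N] v - {(- ?N) # v}. ?g w)"
        by (rule sum.remove[OF finite_shuffles first])
      also have "\<dots> = (\<Sum>w\<in>shuffles [- ?N] v - {(- ?N) # v}. ?g w)"
        by simp
      also have "\<dots> = (\<Sum>w\<in>shuffles [- ?N] v - {(- ?N) # v}. weight (0 # w))"
      proof (rule sum.cong[OF refl])
        fix w assume "w \<in> shuffles [- ?N] v - {(- ?N) # v}"
        then have "\<not> starts_below 0 w" using rest False by blast
        then show "?g w = weight (0 # w)" by simp
      qed
      also have "\<dots> = (\<Sum>w\<in>shuffles [- ?N] v. weight (0 # w)) - weight (0 # (- ?N) # v)"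
        using sum.remove[OF finite_shuffles first, where g = "\<lambda>w. weight (0 # w)"]
        by (simp only: add_diff_cancel_left')
      finally show ?thesis .
    qed
    moreover have "weight (0 # (- ?N) # v) = X ^ Suc d"
      using False b unfolding d_def by (cases v) (auto simp: weight_def)
    ultimately have "?P + ?M = ((\<Sum>w\<in>shuffles [?N] v. weight (0 # w)) +
        (\<Sum>w\<in>shuffles [- ?N] v. weight (0 # w))) - X ^ Suc d"
      by (simp only: add_diff_eq)
    also have "\<dots> = X ^ d + (2 * of_nat d * X ^ d + (2 * of_nat n - 4 * of_nat d) * X ^ Suc d)"
      unfolding sum_all_children[OF v, folded d_def] using False
      by (simp only: of_bool_eq not_False_eq_True add_0_right) (simp only: algebra_simps)
    finally show ?thesis using False by (simp only: of_bool_eq not_False_eq_True mult_1_left)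
  qed
qed

lemma guarded_power_eq_weight:
  "(if no_double_descent (0 # w) then k * X ^ descents (0 # w) else 0) = k * weight (0 # w)"
  by (simp add: weight_def)

lemma X_pderiv_power: "X * pderiv (X ^ d) = of_nat d * X ^ d"
proof (induction d)
  case 0
  then show ?case by simp
next
  case (Suc d)
  have pderiv_X: "pderiv X = 1" by (simp add: pderiv_pCons)
  have "X * pderiv (X ^ Suc d) = X * (X * pderiv (X ^ d)) + X * X ^ d"
    by (simp only: power_Suc pderiv_mult pderiv_X mult_1_right distrib_left)
  also have "\<dots> = of_nat (Suc d) * X ^ Suc d"
    unfolding Suc.IH power_Suc of_nat_Suc by (simp only: algebra_simps)
  finally show ?case .
qed

text \<open>
  This identity moves the descent number from the coefficients into the operator \<open>2 x (1 - 2 x) d/dx\<close>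
  of the recurrences, so that they can be summed over all words.
\<close>

lemma derivative_term:
  "2 * of_nat d * X ^ d + (k - 4 * of_nat d) * X ^ Suc d =
    k * X * X ^ d + 2 * X * (1 - 2 * X) * pderiv (X ^ d)"
proof -
  have "2 * X * (1 - 2 * X) * pderiv (X ^ d) = 2 * (1 - 2 * X) * (X * pderiv (X ^ d))"
    by (simp only: mult_ac)
  also have "\<dots> = 2 * (1 - 2 * X) * (of_nat d * X ^ d)"
    by (simp only: X_pderiv_power)
  finally show ?thesis by (simp only: power_Suc) (simp only: algebra_simps)
qed

lemmas pderiv_sum = higher_pderiv_sum[of 1, simplified]

lemma word_poly_Suc:
  "word_poly (Suc n) = (1 + of_nat (2 * n + 1) * X) * word_poly n
    + 2 * X * (1 - 2 * X) * pderiv (word_poly n) + X * word_poly_minus n"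
proof -
  have "word_poly (Suc n) = (\<Sum>v\<in>simsun_words n.
      (\<Sum>w\<in>shuffles [int (Suc n)] v. weight (0 # w)) +
      (\<Sum>w\<in>shuffles [- int (Suc n)] v. weight (0 # w)))"
    unfolding word_poly_def sum_simsun_words_Suc weight_def ..
  also have "\<dots> = (\<Sum>v\<in>simsun_words n. let d = descents (0 # v) in
      (1 + of_nat (2 * n + 1) * X) * X ^ d + 2 * X * (1 - 2 * X) * pderiv (X ^ d) +
      X * (of_bool (starts_below 0 v) * X ^ d))"
  proof (rule sum.cong[OF refl], unfold Let_def)
    fix v assume v: "v \<in> simsun_words n"
    let ?d = "descents (0 # v)"
    have "(1 + 2 * of_nat ?d) * X ^ ?d
        + (2 * of_nat n + 1 - 4 * of_nat ?d + of_bool (starts_below 0 v)) * X ^ Suc ?d =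
      X ^ ?d + (2 * of_nat ?d * X ^ ?d + (of_nat (2 * n + 1) - 4 * of_nat ?d) * X ^ Suc ?d) +
        of_bool (starts_below 0 v) * X ^ Suc ?d"
      by (simp del: descents.simps add: algebra_simps)
    also have "\<dots> = (1 + of_nat (2 * n + 1) * X) * X ^ ?d + 2 * X * (1 - 2 * X) * pderiv (X ^ ?d) +
      X * (of_bool (starts_below 0 v) * X ^ ?d)"
      unfolding derivative_term by (simp only: power_Suc algebra_simps)
    finally show "(\<Sum>w\<in>shuffles [int (Suc n)] v. weight (0 # w)) +
        (\<Sum>w\<in>shuffles [- int (Suc n)] v. weight (0 # w)) = \<dots>"
      unfolding sum_all_children[OF v] .
  qed
  also have "\<dots> = (1 + of_nat (2 * n + 1) * X) * word_poly n
    + 2 * X * (1 - 2 * X) * pderiv (word_poly n) + X * word_poly_minus n"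
    by (simp only: Let_def sum.distrib word_poly_def word_poly_minus_def pderiv_sum sum_distrib_left)
  finally show ?thesis .
qed

lemma word_poly_plus_Suc:
  "word_poly_plus (Suc n) = of_nat (2 * n) * X * word_poly_plus n
    + 2 * X * (1 - 2 * X) * pderiv (word_poly_plus n) + word_poly n"
proof -
  let ?g = "\<lambda>w. of_bool (\<not> starts_below 0 w) * weight (0 # w)"
  have "word_poly_plus (Suc n) = (\<Sum>v\<in>simsun_words n.
      (\<Sum>w\<in>shuffles [int (Suc n)] v. ?g w) + (\<Sum>w\<in>shuffles [- int (Suc n)] v. ?g w))"
    unfolding word_poly_plus_def sum_simsun_words_Suc guarded_power_eq_weight ..
  also have "\<dots> = (\<Sum>v\<in>simsun_words n.
      let d = descents (0 # v); p = of_bool (\<not> starts_below 0 v) in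
      of_nat (2 * n) * X * (p * X ^ d) + 2 * X * (1 - 2 * X) * pderiv (p * X ^ d) + X ^ d)"
  proof (rule sum.cong[OF refl], unfold Let_def)
    fix v assume v: "v \<in> simsun_words n"
    let ?d = "descents (0 # v)"
    let ?p = "of_bool (\<not> starts_below 0 v) :: int poly"
    have "X ^ ?d + ?p * (2 * of_nat ?d * X ^ ?d + (2 * of_nat n - 4 * of_nat ?d) * X ^ Suc ?d)
      = of_nat (2 * n) * X * (?p * X ^ ?d) + 2 * X * (1 - 2 * X) * pderiv (?p * X ^ ?d) + X ^ ?d"
      unfolding derivative_term by (cases "starts_below 0 v") (simp_all del: descents.simps)
    then show "(\<Sum>w\<in>shuffles [int (Suc n)] v. ?g w) + (\<Sum>w\<in>shuffles [- int (Suc n)] v. ?g w) =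
      of_nat (2 * n) * X * (?p * X ^ ?d) + 2 * X * (1 - 2 * X) * pderiv (?p * X ^ ?d) + X ^ ?d"
      unfolding sum_positive_children[OF v] .
  qed
  also have "\<dots> = of_nat (2 * n) * X * word_poly_plus n
    + 2 * X * (1 - 2 * X) * pderiv (word_poly_plus n) + word_poly n"
    by (simp only: Let_def sum.distrib word_poly_def word_poly_plus_def pderiv_sum sum_distrib_left)
  finally show ?thesis .
qed

text \<open>
  Counting negative children is avoided: both sides of the recurrence are the differences
  of those of \<open>word_poly_Suc\<close> and \<open>word_poly_plus_Suc\<close>.
\<close>

lemma word_poly_minus_Suc:
  "word_poly_minus (Suc n) = of_nat (2 * n + 1) * X * word_poly_minus n
    + 2 * X * (1 - 2 * X) * pderiv (word_poly_minus n) + X * word_poly n"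
proof -
  have "word_poly_minus (Suc n) = word_poly (Suc n) - word_poly_plus (Suc n)"
    by (simp add: word_poly_split)
  also have "\<dots> = of_nat (2 * n + 1) * X * word_poly_minus n
    + 2 * X * (1 - 2 * X) * pderiv (word_poly_minus n) + X * word_poly n"
    unfolding word_poly_Suc word_poly_plus_Suc
    unfolding word_poly_split[of n] pderiv_add of_nat_add of_nat_1
    by (simp only: algebra_simps)
  finally show ?thesis .
qed

section \<open>Signed permutations and their words\<close>

text \<open>The usual window notation \<open>[\<pi>(1), \<dots>, \<pi>(n)]\<close>.\<close>

definition window :: "nat \<Rightarrow> (int \<Rightarrow> int) \<Rightarrow> int list" where
  "window n \<pi> = map \<pi> [1..int n]"

lemma word_eq_window: "\<pi> \<in> signed_perms n \<Longrightarrow> word n \<pi> = 0 # window n \<pi>"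
proof -
  assume "\<pi> \<in> signed_perms n"
  then have "\<pi> 0 = 0" by (auto simp: signed_perms_def permutes_not_in)
  then show ?thesis by (simp add: word_def window_def upto_rec1)
qed

text \<open>
  The statement is for an interval \<open>[k..m]\<close> with arbitrary left end so that it can be proved by
  induction; only \<open>k = 0\<close> is of interest.
\<close>

lemma descents_map_upto:
  "descents (map \<pi> [k..m]) = card {i \<in> {k..m - 1}. \<pi> i > \<pi> (i + 1)}"
proof (induction k m rule: upto.induct)
  case (1 k m)
  show ?case
  proof (cases "k \<le> m")
    case True
    have eq: "{i \<in> {k..m - 1}. \<pi> i > \<pi> (i + 1)} =
      (if k < m \<and> \<pi> k > \<pi> (k + 1) then insert k else id) {i \<in> {k + 1..m - 1}. \<pi> i > \<pi> (i + 1)}"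
      by (auto simp: order_le_less)
    have "card {i \<in> {k..m - 1}. \<pi> i > \<pi> (i + 1)} =
      of_bool (k < m \<and> \<pi> k > \<pi> (k + 1)) + card {i \<in> {k + 1..m - 1}. \<pi> i > \<pi> (i + 1)}"
      unfolding eq by (simp add: card_insert_if del: atLeastAtMost_iff) simp
    moreover have "starts_below (\<pi> k) (map \<pi> [k + 1..m]) \<longleftrightarrow> k < m \<and> \<pi> k > \<pi> (k + 1)"
      by (cases "k < m") (simp_all add: upto_rec1)
    ultimately show ?thesis
      using True 1 by (simp add: upto_rec1)
  qed simp
qed

lemma no_double_descent_map_upto:
  "no_double_descent (map \<pi> [k..m]) \<longleftrightarrow>
    {i \<in> {k + 1..m - 1}. \<pi> (i - 1) > \<pi> i \<and> \<pi> i > \<pi> (i + 1)} = {}"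
proof (induction k m rule: upto.induct)
  case (1 k m)
  show ?case
  proof (cases "k + 1 \<le> m")
    case True
    have "{i \<in> {k + 1..m - 1}. \<pi> (i - 1) > \<pi> i \<and> \<pi> i > \<pi> (i + 1)} =
      (if k + 1 < m \<and> \<pi> k > \<pi> (k + 1) \<and> \<pi> (k + 1) > \<pi> (k + 2)
       then insert (k + 1) else id)
       {i \<in> {(k + 1) + 1..m - 1}. \<pi> (i - 1) > \<pi> i \<and> \<pi> i > \<pi> (i + 1)}"
      by (auto simp: order_le_less ac_simps)
    moreover have "starts_below (\<pi> (k + 1)) (map \<pi> [k + 2..m]) \<longleftrightarrow>
        k + 1 < m \<and> \<pi> (k + 1) > \<pi> (k + 2)"
      by (cases "k + 1 < m") (simp_all add: upto_rec1)
    moreover have "[k..m] = k # (k + 1) # [k + 2..m]" "[k + 1..m] = (k + 1) # [k + 2..m]"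
      using True upto_rec1[of "k + 1" m] by (simp_all add: upto_rec1 ac_simps)
    ultimately show ?thesis
      using True 1 by simp
  next
    case False
    then show ?thesis by (cases "k = m") auto
  qed
qed

lemma des_B_eq_descents: "des_B n \<pi> = descents (word n \<pi>)"
  by (simp add: des_B_def word_def descents_map_upto)

lemma double_descents_empty_iff: "double_descents n \<pi> = {} \<longleftrightarrow> no_double_descent (word n \<pi>)"
  using no_double_descent_map_upto[of \<pi> 0 "int n"] by (simp add: double_descents_def word_def)

lemma window_in_signed_words:
  assumes "\<pi> \<in> signed_perms n"
  shows "window n \<pi> \<in> signed_words n"
proof -
  have perm: "\<pi> permutes ({- int n..int n} - {0})" and odd: "\<pi> (- i) = - \<pi> i" for i
    using assms by (auto simp: signed_perms_def)
  have inj: "\<pi> i = \<pi> j \<longleftrightarrow> i = j" for i j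
    using permutes_inj[OF perm] by (auto dest: injD)
  have "inj_on (\<lambda>i. \<bar>\<pi> i\<bar>) {1..int n}"
  proof (rule inj_onI)
    fix i j assume ij: "i \<in> {1..int n}" "j \<in> {1..int n}" "\<bar>\<pi> i\<bar> = \<bar>\<pi> j\<bar>"
    then have "\<pi> i = \<pi> j \<or> \<pi> i = \<pi> (- j)" by (auto simp: odd abs_eq_iff)
    then show "i = j" using ij by (auto simp: inj)
  qed
  moreover have "(\<lambda>i. \<bar>\<pi> i\<bar>) ` {1..int n} \<subseteq> {1..int n}"
  proof
    fix y assume "y \<in> (\<lambda>i. \<bar>\<pi> i\<bar>) ` {1..int n}"
    then obtain i where i: "i \<in> {1..int n}" "y = \<bar>\<pi> i\<bar>" by auto
    then have "\<pi> i \<in> {- int n..int n} - {0}" by (subst permutes_in_image[OF perm]) auto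
    then show "y \<in> {1..int n}" using i by auto
  qed
  ultimately have bij: "bij_betw (\<lambda>i. \<bar>\<pi> i\<bar>) {1..int n} {1..int n}"
    by (intro bij_betw_imageI card_subset_eq) (simp_all add: card_image)
  have "map abs (window n \<pi>) = map (\<lambda>i. \<bar>\<pi> i\<bar>) [1..int n]" by (simp add: window_def)
  moreover have "distinct \<dots>" "set \<dots> = {1..int n}"
    using bij by (auto simp: bij_betw_def distinct_map)
  ultimately show ?thesis by (metis (mono_tags) signed_words_def mem_Collect_eq set_map)
qed

lemma window_inj_on: "inj_on (window n) (signed_perms n)"
proof (rule inj_onI)
  fix \<pi> \<sigma> assume \<pi>: "\<pi> \<in> signed_perms n" and \<sigma>: "\<sigma> \<in> signed_perms n"
    and eq: "window n \<pi> = window n \<sigma>"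
  have pos: "\<pi> i = \<sigma> i" if "i \<in> {1..int n}" for i
    using eq that by (simp add: window_def)
  show "\<pi> = \<sigma>"
  proof
    fix i
    consider "i \<in> {1..int n}" | "- i \<in> {1..int n}" | "i \<notin> {- int n..int n} - {0}"
      by fastforce
    then show "\<pi> i = \<sigma> i"
    proof cases
      case 2
      then have "\<pi> (- i) = \<sigma> (- i)" by (rule pos)
      then show ?thesis using \<pi> \<sigma> by (simp add: signed_perms_def)
    next
      case 3
      then have "\<pi> i = i" "\<sigma> i = i"
        using \<pi> \<sigma> unfolding signed_perms_def by (blast dest: permutes_not_in)+
      then show ?thesis by simp
    qed (rule pos)
  qed
qed

lemma window_surj:
  assumes w: "w \<in> signed_words n"
  shows "\<exists>\<pi>\<in>signed_perms n. window n \<pi> = w"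
proof -
  have len: "length w = n" using w by (rule length_signed_word)
  have dist: "distinct (map abs w)" and abs_w: "abs ` set w = {1..int n}"
    using w by (auto simp: signed_words_def)
  \<comment> \<open>\<open>p\<close> reads off the letters at positive positions; \<open>\<pi>\<close> is its odd extension.\<close>
  define p where "p i = (if 1 \<le> i \<and> i \<le> int n then w ! nat (i - 1) else i)" for i
  define \<pi> where "\<pi> i = sgn i * p \<bar>i\<bar>" for i :: int
  let ?A = "{- int n..int n} - {0}"
  have p_abs: "\<bar>p i\<bar> \<in> {1..int n}" if "i \<in> {1..int n}" for i
  proof -
    have "p i \<in> set w" using that len by (auto simp: p_def)
    then show ?thesis using abs_w by auto
  qed
  have p_inj: "i = j" if "i \<in> {1..int n}" "j \<in> {1..int n}" "\<bar>p i\<bar> = \<bar>p j\<bar>" for i j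
  proof -
    have "nat (i - 1) < length w" "nat (j - 1) < length w" using that len by auto
    then have "map abs w ! nat (i - 1) = map abs w ! nat (j - 1)"
      using that len by (simp add: p_def)
    then have "nat (i - 1) = nat (j - 1)"
      using that len by (subst (asm) nth_eq_iff_index_eq[OF dist]) auto
    then show ?thesis using that by auto
  qed
  have outside: "\<pi> i = i" if "i \<notin> ?A" for i
    using that by (auto simp: \<pi>_def p_def sgn_mult_abs)
  have mem_A: "i \<in> ?A \<longleftrightarrow> \<bar>i\<bar> \<in> {1..int n}" for i by auto
  have abs_\<pi>: "\<bar>\<pi> i\<bar> = \<bar>p \<bar>i\<bar>\<bar>" if "i \<in> ?A" for i
    using that by (simp add: \<pi>_def abs_mult abs_sgn_eq)
  have "\<pi> permutes ?A"
  proof (rule inj_imp_permutes)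
    show "inj_on \<pi> ?A"
    proof (rule inj_onI)
      fix i j assume ij: "i \<in> ?A" "j \<in> ?A" "\<pi> i = \<pi> j"
      then have "\<bar>p \<bar>i\<bar>\<bar> = \<bar>p \<bar>j\<bar>\<bar>" using abs_\<pi> by metis
      then have eq: "\<bar>i\<bar> = \<bar>j\<bar>" using ij p_inj mem_A by blast
      moreover have "p \<bar>i\<bar> \<noteq> 0" using ij(1) p_abs[of "\<bar>i\<bar>"] mem_A by fastforce
      ultimately have "sgn i = sgn j" using ij(3) by (simp add: \<pi>_def)
      then show "i = j" using eq by (metis sgn_mult_abs)
    qed
    show "\<pi> i \<in> ?A" if "i \<in> ?A" for i
      using that p_abs abs_\<pi> mem_A by metis
  qed (use outside in auto)
  then have "\<pi> \<in> signed_perms n"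
    by (simp add: signed_perms_def \<pi>_def)
  moreover have "window n \<pi> = w"
    by (rule nth_equalityI) (auto simp: window_def len \<pi>_def p_def)
  ultimately show ?thesis by blast
qed

text \<open>
  Removing the \<open>k\<close> largest entries is truncation to rank \<open>n - k\<close>. The result is automatically the
  word of a signed permutation, because windows are exactly the signed words; what remains of the
  simsun condition is the absence of double descents.
\<close>

lemma simsun_B_iff:
  "\<pi> \<in> simsun_B n \<longleftrightarrow> \<pi> \<in> signed_perms n \<and> window n \<pi> \<in> simsun_words n"
proof (cases "\<pi> \<in> signed_perms n")
  case True
  let ?w = "window n \<pi>"
  have w: "?w \<in> signed_words n" using True by (rule window_in_signed_words)
  have step: "(\<exists>\<sigma> \<in> signed_perms (n - k). remove_largest n k (word n \<pi>) = word (n - k) \<sigma> \<and>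
      double_descents (n - k) \<sigma> = {}) \<longleftrightarrow> no_double_descent (0 # truncate (n - k) ?w)"
    if k: "k \<le> n" for k
  proof -
    have "\<bar>x\<bar> \<in> {1..int n}" if "x \<in> set ?w" for x
      using w that by (auto simp: signed_words_def)
    then have rem: "remove_largest n k (word n \<pi>) = 0 # truncate (n - k) ?w"
      using k unfolding word_eq_window[OF True] remove_largest_def truncate_def
      by (auto simp: of_nat_diff intro!: filter_cong)
    obtain \<sigma> where \<sigma>: "\<sigma> \<in> signed_perms (n - k)" "window (n - k) \<sigma> = truncate (n - k) ?w"
      using window_surj[OF truncate_signed_word[OF w]] by (meson diff_le_self)
    show ?thesis
      unfolding rem double_descents_empty_iff
      using \<sigma> by (metis word_eq_window)
  qed
  have "(\<forall>k\<le>n. P (n - k)) \<longleftrightarrow> (\<forall>m\<le>n. P m)" for P :: "nat \<Rightarrow> bool"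
    by (metis diff_diff_cancel diff_le_self)
  then show ?thesis
    using True w step by (simp add: simsun_B_def simsun_words_def)
qed (simp add: simsun_B_def)

lemma sum_simsun_B: "(\<Sum>\<pi>\<in>simsun_B n. f (window n \<pi>)) = (\<Sum>w\<in>simsun_words n. f w)"
proof (rule sum.reindex_bij_betw)
  have "inj_on (window n) (simsun_B n)"
    by (rule inj_on_subset[OF window_inj_on]) (auto simp: simsun_B_iff)
  moreover have "window n ` simsun_B n = simsun_words n"
    using window_surj by (force simp: simsun_B_iff simsun_words_def)
  ultimately show "bij_betw (window n) (simsun_B n) (simsun_words n)"
    by (simp add: bij_betw_def)
qed

lemma simsun_words_0: "simsun_words 0 = {[]}"
  by (auto simp: simsun_words_def signed_words_def truncate_def)

lemma des_B_window: "\<pi> \<in> simsun_B n \<Longrightarrow> des_B n \<pi> = descents (0 # window n \<pi>)"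
  by (simp add: des_B_eq_descents word_eq_window simsun_B_iff)

lemma finite_simsun_B: "finite (simsun_B n)"
proof (rule inj_on_finite)
  show "inj_on (window n) (simsun_B n)"
    by (rule inj_on_subset[OF window_inj_on]) (auto simp: simsun_B_iff)
  show "window n ` simsun_B n \<subseteq> simsun_words n" by (auto simp: simsun_B_iff)
qed (rule finite_simsun_words)

lemma starts_below_window:
  assumes "\<pi> \<in> simsun_B n" "n > 0"
  shows "starts_below 0 (window n \<pi>) \<longleftrightarrow> \<pi> 1 < 0"
    "\<not> starts_below 0 (window n \<pi>) \<longleftrightarrow> \<pi> 1 > 0"
proof -
  have perm: "\<pi> permutes ({- int n..int n} - {0})"
    using assms by (auto simp: simsun_B_iff signed_perms_def)
  have "\<pi> 1 \<in> {- int n..int n} - {0}"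
    using \<open>n > 0\<close> by (subst permutes_in_image[OF perm]) auto
  then show "starts_below 0 (window n \<pi>) \<longleftrightarrow> \<pi> 1 < 0"
    "\<not> starts_below 0 (window n \<pi>) \<longleftrightarrow> \<pi> 1 > 0"
    using \<open>n > 0\<close> by (auto simp: window_def upto_rec1)
qed

section \<open>The recurrences for signed simsun permutations\<close>

lemma R_eq_word_poly: "R n = word_poly n"
proof (cases "n = 0")
  case False
  have "R n = (\<Sum>\<pi>\<in>simsun_B n. X ^ descents (0 # window n \<pi>))"
    using False by (simp add: R_def des_B_window del: descents.simps)
  then show ?thesis
    by (simp add: sum_simsun_B[of "\<lambda>w. X ^ descents (0 # w)"] word_poly_def del: descents.simps)
qed (simp add: R_def word_poly_def simsun_words_0)

lemma R_plus_eq_word_poly_plus: "R_plus n = word_poly_plus n"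
proof (cases "n = 0")
  case False
  have "R_plus n = (\<Sum>\<pi>\<in>simsun_B n. if \<pi> 1 > 0 then X ^ des_B n \<pi> else 0)"
    using False
    by (simp add: R_plus_def simsun_B_plus_def sum.inter_filter[OF finite_simsun_B])
  also have "\<dots> = (\<Sum>\<pi>\<in>simsun_B n.
      of_bool (\<not> starts_below 0 (window n \<pi>)) * X ^ descents (0 # window n \<pi>))"
    using False by (intro sum.cong refl) (simp add: starts_below_window(2) des_B_window del: descents.simps)
  finally show ?thesis
    using sum_simsun_B[of "\<lambda>w. of_bool (\<not> starts_below 0 w) * X ^ descents (0 # w)"]
    by (simp add: word_poly_plus_def del: descents.simps)
qed (simp add: R_plus_def word_poly_plus_def simsun_words_0)

lemma R_minus_eq_word_poly_minus: "R_minus n = word_poly_minus n"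
proof (cases "n = 0")
  case False
  have "R_minus n = (\<Sum>\<pi>\<in>simsun_B n. if \<pi> 1 < 0 then X ^ des_B n \<pi> else 0)"
    using False
    by (simp add: R_minus_def simsun_B_minus_def sum.inter_filter[OF finite_simsun_B])
  also have "\<dots> = (\<Sum>\<pi>\<in>simsun_B n.
      of_bool (starts_below 0 (window n \<pi>)) * X ^ descents (0 # window n \<pi>))"
    using False by (intro sum.cong refl) (simp add: starts_below_window(1) des_B_window del: descents.simps)
  finally show ?thesis
    using sum_simsun_B[of "\<lambda>w. of_bool (starts_below 0 w) * X ^ descents (0 # w)"]
    by (simp add: word_poly_minus_def del: descents.simps)
qed (simp add: R_minus_def word_poly_minus_def simsun_words_0)

theorem proposition2:
  "(\<forall>n::nat.
      R_plus (n + 1) =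
        of_nat (2 * n) * X * R_plus n + 2 * X * (1 - 2 * X) * pderiv (R_plus n) + R n \<and>
      R_minus (n + 1) =
        of_nat (2 * n + 1) * X * R_minus n + 2 * X * (1 - 2 * X) * pderiv (R_minus n) + X * R n \<and>
      R (n + 1) =
        (1 + of_nat (2 * n + 1) * X) * R n + 2 * X * (1 - 2 * X) * pderiv (R n) + X * R_minus n) \<and>
   R_plus 0 = 1 \<and> R 0 = 1 \<and> R_minus 0 = 0"
  unfolding R_eq_word_poly R_plus_eq_word_poly_plus R_minus_eq_word_poly_minus
  using word_poly_Suc word_poly_plus_Suc word_poly_minus_Suc
  by (simp add: word_poly_def word_poly_plus_def word_poly_minus_def simsun_words_0)

end
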